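(* For all $n\ge2$ and all integers $k$ with $0\le k<n$, $$G^{\mathrm{I}}_{2n,2k+2}=G^{\mathrm{I}}_{2n,2k}+\sum_{i=k}^{n-1}G^{\mathrm{I}}_{2n-2,2i}.$$
   Context: For $m\ge1$, $\mathfrak{G}^{\mathrm{I}}_{2m}$ is the set of permutations $\pi=\pi_1\cdots\pi_{2m}$ of $[2m]$ such that every ascent $\pi_i<\pi_{i+1}$ has $\pi_i$ odd and $\pi_{i+1}$ even. For $1\le j\le 2m$, $G^{\mathrm{I}}_{2m,j}$ denotes the number of $\pi\in\mathfrak{G}^{\mathrm{I}}_{2m}$ with $\pi_1=j$, and by convention $G^{\mathrm{I}}_{2m,j}=0$ for $j<1$ or $j>2m$. *)

theory Defs
  imports "HOL-Combinatorics.Multiset_Permutations"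
begin

text \<open>
  Permutations \<open>\<pi> = \<pi>\<^sub>1 \<dots> \<pi>\<^sub>2\<^sub>m\<close> are written in one-line notation, as lists; list positions
  start at 0, so \<open>\<pi>\<^sub>i\<close> is \<open>\<pi> ! (i - 1)\<close>. The parameter of both definitions below is \<open>m\<close>,
  not the size \<open>2 * m\<close>.
\<close>

definition perms_GI :: "nat \<Rightarrow> nat list set" where
  "perms_GI m = {\<pi> \<in> permutations_of_set {1..2 * m}.
     \<forall>i. Suc i < length \<pi> \<longrightarrow> \<pi> ! i < \<pi> ! Suc i \<longrightarrow> odd (\<pi> ! i) \<and> even (\<pi> ! Suc i)}"

text \<open>\<open>num_GI m j\<close> is \<open>G\<^sup>I\<close> with subscript \<open>(2m, j)\<close>.\<close>

definition num_GI :: "nat \<Rightarrow> nat \<Rightarrow> nat" where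
  "num_GI m j = (if 1 \<le> j \<and> j \<le> 2 * m then card {\<pi> \<in> perms_GI m. hd \<pi> = j} else 0)"

end

theory Submission
  imports Defs
begin

text \<open>
  Cut a permutation at all positions where a letter below \<open>x\<close> meets a letter that is at least \<open>x\<close>:
  the letters \<open>\<ge> x\<close> form nonempty blocks, and those that follow a smaller letter must start with
  an even letter. The number of ways to fill the blocks depends only on their number, whether an
  initial block is present (it then has to start with the prescribed first letter), and \<open>x\<close>.
  Removing the smallest letter \<open>x\<close> gives linear recurrences in the number \<open>b\<close> of non-initial blocks.
  With \<open>(D q) b = (b + 1) (q b + q (b + 1))\<close> (\<open>odd_step\<close>), the shift \<open>(T q) b = q (b - 1)\<close>, \<open>(T q) 0 = 0\<close>,
  \<open>A = D (T D + 1)\<close> (\<open>pair_low\<close>) and \<open>B = D D T\<close> (\<open>pair_high\<close>), one gets for \<open>1 \<le> k < n\<close> that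
  \<open>G\<^sup>I\<close> with subscript \<open>(2n, 2k)\<close> is the value at 0 of \<open>A\<^bsup>k-1\<^esup> D T B\<^bsup>n-k-1\<^esup> \<delta>\<^sub>0\<close>, and for \<open>k = n\<close> that
  of \<open>A\<^bsup>n-1\<^esup> \<delta>\<^sub>0\<close>. Since \<open>A = D T D + D\<close> and \<open>B = A + D T\<close>, both the difference in \<open>k\<close> and the partial
  sums of the claim equal the value at 0 of \<open>A\<^bsup>k-1\<^esup> B\<^bsup>n-k-1\<^esup> \<delta>\<^sub>0\<close>.
\<close>

section \<open>Fillings of blocks and reinsertion of the smallest letter\<close>

definition allowed :: "nat \<Rightarrow> nat \<Rightarrow> bool" where
  "allowed a b \<longleftrightarrow> (a < b \<longrightarrow> odd a \<and> even b)"

text \<open>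
  Fillings of the blocks labelled by \<open>L\<close> with the letters \<open>X\<close>. A non-initial block is labelled by
  the letter that was removed in front of it, or keeps an older label; 0 labels the initial block,
  which has to start with \<open>j\<close>. As only even \<open>j\<close> occur, all blocks start with an even letter.
\<close>
definition fillings :: "nat \<Rightarrow> nat set \<Rightarrow> nat set \<Rightarrow> (nat \<Rightarrow> nat list) set" where
  "fillings j X L = {f. (\<forall>l. f l \<noteq> [] \<longleftrightarrow> l \<in> L)
     \<and> (\<forall>l. distinct (f l) \<and> successively allowed (f l))
     \<and> (\<forall>l y. y \<in> set (f l) \<longrightarrow> y \<in> X) \<and> (\<forall>y\<in>X. \<exists>l. y \<in> set (f l))
     \<and> (\<forall>l l' y. y \<in> set (f l) \<longrightarrow> y \<in> set (f l') \<longrightarrow> l = l')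
     \<and> (\<forall>l\<in>L. even (hd (f l)) \<and> (l = 0 \<longrightarrow> hd (f l) = j))}"

text \<open>
  Inverse of removing the letter \<open>x\<close> from block \<open>l\<close>: what follows \<open>x\<close> becomes the block labelled \<open>x\<close>.
  Empty lists stand for absent blocks, so this also covers \<open>x\<close> at either end of its block.
\<close>
definition join :: "nat \<Rightarrow> nat \<Rightarrow> (nat \<Rightarrow> nat list) \<Rightarrow> nat \<Rightarrow> nat list" where
  "join l x g = g(l := g l @ x # g x, x := [])"

lemma fillings_nonempty_iff: "f \<in> fillings j X L \<Longrightarrow> f l \<noteq> [] \<longleftrightarrow> l \<in> L"
  by (simp add: fillings_def)

lemma finite_fillings:
  assumes "finite X" "finite L"
  shows "finite (fillings j X L)"
proof (rule finite_subset)
  show "fillings j X L \<subseteq> {f. \<forall>l. (l \<in> L \<longrightarrow> f l \<in> {xs. set xs \<subseteq> X \<and> distinct xs}) \<and> (l \<notin> L \<longrightarrow> f l = [])}"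
    by (auto simp: fillings_def)
  show "finite {f. \<forall>l. (l \<in> L \<longrightarrow> f l \<in> {xs. set xs \<subseteq> X \<and> distinct xs}) \<and> (l \<notin> L \<longrightarrow> f l = [])}"
    using assms by (intro finite_set_of_finite_funs finite_subset_distinct)
qed

text \<open>Since \<open>x\<close> occurs in neither \<open>g\<close> nor \<open>h\<close>, its
  place in the joined block marks the cut, so both pieces can be read off.\<close>

lemma inj_on_join:
  assumes "l \<noteq> x"
  shows "inj_on (join l x) {g. \<forall>y. x \<notin> set (g y)}"
proof (rule inj_onI)
  fix g h
  assume *: "g \<in> {g. \<forall>y. x \<notin> set (g y)}" "h \<in> {g. \<forall>y. x \<notin> set (g y)}" "join l x g = join l x h"
  have eq: "join l x g y = join l x h y" for y
    using *(3) by simp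
  have "g l @ x # g x = h l @ x # h x"
    using eq[of l] assms by (simp add: join_def)
  then have lx: "g l = h l" "g x = h x"
    using *(1,2) by (auto simp: append_Cons_eq_iff)
  show "g = h"
  proof
    fix y
    show "g y = h y"
      using eq[of y] lx by (cases "y = l \<or> y = x") (auto simp: join_def)
  qed
qed

text \<open>A predecessor of the smallest letter \<open>x\<close> exceeds it and is unrestricted,
  while a successor has to be even and forces \<open>x\<close> to be odd. So either \<open>x\<close>
  follows other letters of block \<open>l\<close>, with a remainder labelled \<open>x\<close> only
  if \<open>x\<close> is odd, or \<open>x\<close> is all of block \<open>l\<close>, which needs
  \<open>x\<close> even and, for \<open>l = 0\<close>, equal to \<open>j\<close>.\<close>

lemma join_in_fillings:
  assumes X: "\<forall>y\<in>X. x < y" and L: "l \<in> L" "x \<notin> L" and g: "g \<in> fillings j X M"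
    and M: "insert x M = insert x L \<and> (x \<in> M \<longrightarrow> odd x) \<or> M = L - {l} \<and> even x \<and> (l = 0 \<longrightarrow> x = j)"
  shows "join l x g \<in> fillings j (insert x X) L"
proof -
  have lx: "l \<noteq> x" using L by auto
  have ne: "g y \<noteq> [] \<longleftrightarrow> y \<in> M" and di: "distinct (g y)" and su: "successively allowed (g y)"
    and X1: "z \<in> set (g y) \<Longrightarrow> z \<in> X" and X2: "z \<in> X \<Longrightarrow> \<exists>y. z \<in> set (g y)"
    and dj: "z \<in> set (g y) \<Longrightarrow> z \<in> set (g y') \<Longrightarrow> y = y'"
    and hd: "y \<in> M \<Longrightarrow> even (hd (g y)) \<and> (y = 0 \<longrightarrow> hd (g y) = j)" for y y' z
    using g by (auto simp: fillings_def)
  have xn: "x \<notin> set (g y)" for y using X1 X by blast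
  have 1: "join l x g y \<noteq> [] \<longleftrightarrow> y \<in> L" for y
    using ne[of y] M L by (auto simp: join_def)
  have 2: "distinct (join l x g y)" for y
    using di[of y] di[of x] di[of l] xn dj[of _ l x] lx by (auto simp: join_def)
  have last: "g l \<noteq> [] \<Longrightarrow> allowed (last (g l)) x"
    using X X1[of "last (g l)" l] by (force simp: allowed_def)
  have first: "g x \<noteq> [] \<Longrightarrow> allowed x (hd (g x))"
    using hd[of x] ne[of x] M L by (auto simp: allowed_def)
  have 3: "successively allowed (join l x g y)" for y
    using su[of y] su[of l] su[of x] last first
    by (auto simp: join_def successively_append_iff successively_Cons)
  have 4: "z \<in> set (join l x g y) \<Longrightarrow> z \<in> insert x X" for y z
    using X1[of z] by (auto simp: join_def split: if_splits)
  have 5: "\<exists>y. z \<in> set (join l x g y)" if z: "z \<in> insert x X" for z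
  proof (cases "z = x")
    case True
    then show ?thesis using lx by (intro exI[of _ l]) (auto simp: join_def)
  next
    case False
    then obtain y where "z \<in> set (g y)" using X2 z by blast
    then show ?thesis using lx
      by (intro exI[of _ "if y = x then l else y"]) (auto simp: join_def)
  qed
  have 6: "y = y'" if "z \<in> set (join l x g y)" "z \<in> set (join l x g y')" for z y y'
    using that dj[of z] xn lx by (fastforce simp: join_def split: if_splits)
  have 7: "even (hd (join l x g y)) \<and> (y = 0 \<longrightarrow> hd (join l x g y) = j)" if "y \<in> L" for y
    using that hd[of y] ne[of y] ne[of l] M L lx by (auto simp: join_def hd_append)
  show ?thesis
    unfolding fillings_def using 1 2 3 4 5 6 7 by blast
qed

text \<open>Converse of \<open>join_in_fillings\<close>: cutting block \<open>l\<close> at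
  \<open>x\<close> recovers \<open>g\<close>, and \<open>M\<close> consists of the labels that then
  carry a nonempty list.\<close>

lemma fillings_join_cases:
  assumes X: "\<forall>y\<in>X. x < y" and L: "l \<in> L" "x \<notin> L" and f: "f \<in> fillings j (insert x X) L"
    and x: "x \<in> set (f l)" "x \<noteq> 0"
  obtains g M where "f = join l x g" "g \<in> fillings j X M"
    "insert x M = insert x L \<and> (x \<in> M \<longrightarrow> odd x) \<or> M = L - {l} \<and> even x \<and> (l = 0 \<longrightarrow> x = j)"
proof -
  have lx: "l \<noteq> x" using L by auto
  have ne: "f y \<noteq> [] \<longleftrightarrow> y \<in> L" and di: "distinct (f y)" and su: "successively allowed (f y)"
    and X1: "z \<in> set (f y) \<Longrightarrow> z \<in> insert x X" and X2: "z \<in> insert x X \<Longrightarrow> \<exists>y. z \<in> set (f y)"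
    and dj: "z \<in> set (f y) \<Longrightarrow> z \<in> set (f y') \<Longrightarrow> y = y'"
    and hd: "y \<in> L \<Longrightarrow> even (hd (f y)) \<and> (y = 0 \<longrightarrow> hd (f y) = j)" for y y' z
    using f unfolding fillings_def by blast+
  obtain u v where fl: "f l = u @ x # v" using x split_list by metis
  have fx: "f x = []" using ne L by blast
  have xX: "x \<notin> X" using X by blast
  define g where "g = f(l := u, x := v)"
  have gl: "g l = u" and gx: "g x = v" and gy: "\<And>y. y \<noteq> l \<Longrightarrow> y \<noteq> x \<Longrightarrow> g y = f y"
    using lx by (auto simp: g_def)
  have xuv: "x \<notin> set u" "x \<notin> set v" "set u \<inter> set v = {}" using di[of l] fl by auto
  define M where "M = {y. g y \<noteq> []}"
  have first: "odd x \<and> even (hd v)" if "v \<noteq> []"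
  proof -
    have "hd v \<in> X" using X1[of "hd v" l] fl that xuv by auto
    moreover have "allowed x (hd v)"
      using su[of l] fl that by (auto simp: successively_append_iff successively_Cons)
    ultimately show ?thesis using X by (auto simp: allowed_def)
  qed
  have start: "even x \<and> (l = 0 \<longrightarrow> x = j)" if "u = []"
    using hd[of l] L fl that by auto
  have join: "f = join l x g"
    using fl fx lx by (auto simp: join_def g_def fun_eq_iff)
  have M: "insert x M = insert x L \<and> (x \<in> M \<longrightarrow> odd x) \<or> M = L - {l} \<and> even x \<and> (l = 0 \<longrightarrow> x = j)"
  proof (cases "u = []")
    case True
    \<comment> \<open>Here \<open>v\<close> is empty as well: as a first letter \<open>x\<close> is
      even, but a successor would make it odd.\<close>
    then have "M = L - {l}"
      using start first lx ne L unfolding M_def by (auto simp: g_def)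
    then show ?thesis using start True by blast
  next
    case False
    then show ?thesis
      using first lx ne L fl unfolding M_def by (auto simp: g_def split: if_splits)
  qed
  \<comment> \<open>Block \<open>x\<close> of \<open>g\<close> was cut off block \<open>l\<close> of
    \<open>f\<close>, so letters are traced back with the label \<open>x\<close> replaced by
    \<open>l\<close>.\<close>
  have sub: "z \<in> set (f (if y = x then l else y))" "z \<noteq> x" if "z \<in> set (g y)" for z y
  proof -
    show "z \<in> set (f (if y = x then l else y))"
      using that fl by (auto simp: g_def split: if_splits)
    show "z \<noteq> x"
      using that xuv x dj[of x l y] by (auto simp: g_def split: if_splits)
  qed
  have 2: "distinct (g y)" for y
    using di[of y] di[of l] fl by (auto simp: g_def)
  have 3: "successively allowed (g y)" for y
    using su[of y] su[of l] fl by (auto simp: g_def successively_append_iff successively_Cons)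
  have 4: "z \<in> X" if "z \<in> set (g y)" for y z
    using sub[OF that] X1 by blast
  have 5: "\<exists>y. z \<in> set (g y)" if z: "z \<in> X" for z
  proof -
    obtain y where y: "z \<in> set (f y)" using X2 z by blast
    have "z \<noteq> x" using z xX by blast
    show ?thesis
    proof (cases "y = l")
      case True
      then have "z \<in> set (g l) \<or> z \<in> set (g x)" using y fl \<open>z \<noteq> x\<close> by (auto simp: gl gx)
      then show ?thesis by blast
    next
      case False
      then show ?thesis using y fx gy[of y] by (intro exI[of _ y]) (cases "y = x"; simp)
    qed
  qed
  have 6: "y = y'" if "z \<in> set (g y)" "z \<in> set (g y')" for z y y'
    using dj[OF sub(1)[OF that(1)] sub(1)[OF that(2)]] that xuv gl gx
    by (auto split: if_splits)
  have 7: "even (hd (g y)) \<and> (y = 0 \<longrightarrow> hd (g y) = j)" if "y \<in> M" for y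
  proof -
    have ney: "g y \<noteq> []" using that by (simp add: M_def)
    consider "y = x" | "y = l" | "y \<noteq> x" "y \<noteq> l" by blast
    then show ?thesis
    proof cases
      case 1
      then show ?thesis using ney first gx x(2) by auto
    next
      case 2
      then show ?thesis using ney hd[of l] L fl gl by auto
    next
      case 3
      then show ?thesis using ney hd[of y] ne gy by auto
    qed
  qed
  have "g \<in> fillings j X M"
    unfolding fillings_def using 2 3 4 5 6 7 by (auto simp: M_def)
  then show ?thesis using that join M by blast
qed

section \<open>Counting fillings by the block of the smallest letter\<close>

definition num_fillings :: "nat \<Rightarrow> nat set \<Rightarrow> nat set \<Rightarrow> nat" where
  "num_fillings j X L = card (fillings j X L)"

lemma fillings_disjoint: "L \<noteq> M \<Longrightarrow> fillings j X L \<inter> fillings j X M = {}"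
  by (auto simp: fillings_def)

lemma card_join_image:
  assumes X: "\<forall>y\<in>X. x < y" and fin: "finite X" "finite A" "\<And>M. M \<in> A \<Longrightarrow> finite M" and lx: "l \<noteq> x"
  shows "card (join l x ` (\<Union>M\<in>A. fillings j X M)) = (\<Sum>M\<in>A. num_fillings j X M)"
proof -
  have "x \<notin> X" using X by blast
  then have "(\<Union>M\<in>A. fillings j X M) \<subseteq> {g. \<forall>y. x \<notin> set (g y)}"
    by (auto simp: fillings_def)
  then have "card (join l x ` (\<Union>M\<in>A. fillings j X M)) = card (\<Union>M\<in>A. fillings j X M)"
    using inj_on_join[OF lx] by (intro card_image) (rule inj_on_subset)
  also have "\<dots> = (\<Sum>M\<in>A. card (fillings j X M))"
    using fin finite_fillings fillings_disjoint by (intro card_UN_disjoint) auto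
  finally show ?thesis by (simp add: num_fillings_def)
qed

text \<open>Classify by the block \<open>l\<close> that contains \<open>x\<close>. The first summand
  has \<open>x\<close> last, after other letters. The second has \<open>x\<close> strictly inside
  the block if \<open>x\<close> is odd, and \<open>x\<close> as the whole block if \<open>x\<close>
  is even; block 0 permits the latter only for \<open>x = j\<close>.\<close>

lemma num_fillings_insert:
  assumes X: "\<forall>y\<in>X. x < y" and fin: "finite X" "finite L" and x: "x \<notin> L" "x \<noteq> 0"
  shows "num_fillings j (insert x X) L = (\<Sum>l\<in>L. num_fillings j X L +
    (if odd x then num_fillings j X (insert x L)
     else if l = 0 \<and> x \<noteq> j then 0 else num_fillings j X (L - {l})))"
proof -
  define A where "A l = {M. insert x M = insert x L \<and> (x \<in> M \<longrightarrow> odd x)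
    \<or> M = L - {l} \<and> even x \<and> (l = 0 \<longrightarrow> x = j)}" for l
  have A: "A l = (if odd x then {L, insert x L} else if l = 0 \<and> x \<noteq> j then {L} else {L, L - {l}})" for l
  proof -
    have "insert x M = insert x L \<longleftrightarrow> M = L \<or> M = insert x L" for M
      using x(1) by (cases "x \<in> M") (auto simp: insert_absorb insert_ident)
    then show ?thesis using x(1) by (auto simp: A_def)
  qed
  have split: "{f \<in> fillings j (insert x X) L. x \<in> set (f l)} = join l x ` (\<Union>M\<in>A l. fillings j X M)"
    if l: "l \<in> L" for l
  proof safe
    fix f assume "f \<in> fillings j (insert x X) L" "x \<in> set (f l)"
    then obtain g M where "f = join l x g" "g \<in> fillings j X M" "M \<in> A l"
      using fillings_join_cases[OF X l x(1) _ _ x(2)] unfolding A_def mem_Collect_eq by metis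
    then show "f \<in> join l x ` (\<Union>M\<in>A l. fillings j X M)" by blast
  next
    fix g M assume "g \<in> fillings j X M" "M \<in> A l"
    then show "join l x g \<in> fillings j (insert x X) L"
      using join_in_fillings[OF X l x(1)] unfolding A_def by blast
    show "x \<in> set (join l x g l)" using l x by (auto simp: join_def)
  qed
  define F where "F l = {f \<in> fillings j (insert x X) L. x \<in> set (f l)}" for l
  have "fillings j (insert x X) L = (\<Union>l\<in>L. F l)"
  proof -
    have "\<exists>l\<in>L. x \<in> set (f l)" if "f \<in> fillings j (insert x X) L" for f
    proof -
      obtain l where "x \<in> set (f l)" using \<open>f \<in> _\<close> by (auto simp: fillings_def)
      moreover from this have "f l \<noteq> []" by auto
      then have "l \<in> L" using \<open>f \<in> _\<close> unfolding fillings_def by blast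
      ultimately show ?thesis by blast
    qed
    then show ?thesis unfolding F_def by blast
  qed
  moreover have "card (\<Union>l\<in>L. F l) = (\<Sum>l\<in>L. card (F l))"
  proof (rule card_UN_disjoint)
    show "\<forall>l\<in>L. finite (F l)"
      using finite_fillings[of "insert x X" L j] fin by (simp add: F_def)
    show "\<forall>l\<in>L. \<forall>l'\<in>L. l \<noteq> l' \<longrightarrow> F l \<inter> F l' = {}"
      unfolding F_def fillings_def by blast
  qed (use fin in auto)
  ultimately have "num_fillings j (insert x X) L = (\<Sum>l\<in>L. card {f \<in> fillings j (insert x X) L. x \<in> set (f l)})"
    unfolding num_fillings_def F_def by presburger
  also have "\<dots> = (\<Sum>l\<in>L. \<Sum>M\<in>A l. num_fillings j X M)"
  proof (rule sum.cong)
    fix l assume l: "l \<in> L"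
    show "card {f \<in> fillings j (insert x X) L. x \<in> set (f l)} = (\<Sum>M\<in>A l. num_fillings j X M)"
      unfolding split[OF l] using l x fin X
      by (intro card_join_image) (auto simp: A split: if_splits)
  qed simp
  also have "\<dots> = (\<Sum>l\<in>L. num_fillings j X L +
    (if odd x then num_fillings j X (insert x L)
     else if l = 0 \<and> x \<noteq> j then 0 else num_fillings j X (L - {l})))"
  proof (rule sum.cong)
    fix l assume "l \<in> L"
    \<comment> \<open>Otherwise the two-element set \<open>A l\<close> could collapse and one
      summand be lost.\<close>
    then have "L \<noteq> insert x L" "L \<noteq> L - {l}" using x(1) by blast+
    then show "(\<Sum>M\<in>A l. num_fillings j X M) = num_fillings j X L +
      (if odd x then num_fillings j X (insert x L)
       else if l = 0 \<and> x \<noteq> j then 0 else num_fillings j X (L - {l}))"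
      by (simp add: A)
  qed simp
  finally show ?thesis .
qed


section \<open>Operators on functions of the number of non-initial blocks\<close>

definition odd_step :: "(nat \<Rightarrow> nat) \<Rightarrow> nat \<Rightarrow> nat" where
  "odd_step q b = Suc b * (q b + q (Suc b))"

definition shift :: "(nat \<Rightarrow> nat) \<Rightarrow> nat \<Rightarrow> nat" where
  "shift q b = (case b of 0 \<Rightarrow> 0 | Suc c \<Rightarrow> q c)"

definition plus_fun :: "(nat \<Rightarrow> nat) \<Rightarrow> (nat \<Rightarrow> nat) \<Rightarrow> nat \<Rightarrow> nat" where
  "plus_fun p q b = p b + q b"

definition pair_low :: "(nat \<Rightarrow> nat) \<Rightarrow> nat \<Rightarrow> nat" where
  "pair_low q = odd_step (plus_fun (shift (odd_step q)) q)"

definition pair_high :: "(nat \<Rightarrow> nat) \<Rightarrow> nat \<Rightarrow> nat" where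
  "pair_high q = odd_step (odd_step (shift q))"

definition unit0 :: "nat \<Rightarrow> nat" where
  "unit0 b = of_bool (b = 0)"

lemma odd_step_plus: "odd_step (plus_fun p q) = plus_fun (odd_step p) (odd_step q)"
  by (simp add: odd_step_def plus_fun_def fun_eq_iff algebra_simps)

lemma shift_plus: "shift (plus_fun p q) = plus_fun (shift p) (shift q)"
  by (auto simp: shift_def plus_fun_def fun_eq_iff split: nat.split)

lemma pair_low_plus: "pair_low (plus_fun p q) = plus_fun (pair_low p) (pair_low q)"
  unfolding pair_low_def odd_step_plus shift_plus by (rule ext) (simp add: plus_fun_def)

lemma funpow_pair_low_plus:
  "(pair_low ^^ m) (plus_fun p q) = plus_fun ((pair_low ^^ m) p) ((pair_low ^^ m) q)"
  by (induction m) (simp_all add: pair_low_plus)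

lemma odd_step_unit0: "odd_step unit0 = unit0"
  by (auto simp: odd_step_def unit0_def)

lemma odd_step_shift_0: "odd_step (shift q) 0 = q 0"
  by (simp add: odd_step_def shift_def)

text \<open>Apply D to the commutation rule D T = T D + T + 1: the term T yields D T, and the rest
  yields A.\<close>

lemma pair_high_eq: "pair_high q = plus_fun (pair_low q) (odd_step (shift q))"
  by (auto simp: pair_high_def pair_low_def plus_fun_def shift_def odd_step_def fun_eq_iff
      algebra_simps split: nat.split)

lemma pair_low_eq: "pair_low q = plus_fun (odd_step (shift (odd_step q))) (odd_step q)"
  by (simp add: pair_low_def odd_step_plus)

section \<open>The claimed recurrence for the operator expressions\<close>

definition even_total :: "nat \<Rightarrow> nat \<Rightarrow> nat" where
  "even_total n k = (if k = 0 then 0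
     else if k < n then (pair_low ^^ (k - 1)) (odd_step (shift ((pair_high ^^ (n - k - 1)) unit0))) 0
     else (pair_low ^^ (k - 1)) unit0 0)"

definition even_diff :: "nat \<Rightarrow> nat \<Rightarrow> nat" where
  "even_diff n k = (pair_low ^^ (k - 1)) ((pair_high ^^ (n - 1 - k)) unit0) 0"

lemma even_total_0 [simp]: "even_total n 0 = 0"
  by (simp add: even_total_def)

text \<open>The identity A = D T D + D turns A D T w into D T B w + B w, because B = D D T. For
  \<open>Suc k = n\<close> the same identity is applied to \<open>unit0\<close>, which D
  fixes.\<close>

lemma even_total_Suc:
  assumes "1 \<le> k" "k < n"
  shows "even_total n (Suc k) = even_total n k + even_diff n k"
proof (cases "Suc k = n")
  case True
  obtain k' where k': "k = Suc k'" using assms by (cases k) auto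
  have "even_total n (Suc k) = (pair_low ^^ k') (pair_low unit0) 0"
    using True[symmetric] k' by (simp add: even_total_def funpow_swap1)
  then show ?thesis
    using True k'
    by (auto simp: even_total_def even_diff_def pair_low_eq[of unit0] odd_step_unit0
        funpow_pair_low_plus plus_fun_def)
next
  case False
  obtain k' where k': "k = Suc k'" using assms by (cases k) auto
  define m where "m = n - k - 2"
  have m: "n - Suc k - 1 = m" "n - k - 1 = Suc m" "n - 1 - k = Suc m" using False assms by (auto simp: m_def)
  define w where "w = (pair_high ^^ m) unit0"
  have "even_total n (Suc k) = (pair_low ^^ k') (pair_low (odd_step (shift w))) 0"
    using False assms m k' by (simp add: even_total_def funpow_swap1 w_def)
  also have "pair_low (odd_step (shift w)) = plus_fun (odd_step (shift (pair_high w))) (pair_high w)"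
    by (simp add: pair_low_eq pair_high_def)
  finally show ?thesis
    using assms k' m by (simp add: even_total_def even_diff_def funpow_pair_low_plus w_def) (simp add: plus_fun_def)
qed

text \<open>With no power of A in front, D T leaves the value at 0 unchanged.\<close>

lemma even_total_1: "2 \<le> n \<Longrightarrow> even_total n 1 = even_diff n 1"
  by (simp add: even_total_def even_diff_def odd_step_shift_0 numeral_2_eq_2)

text \<open>Replace the factor B next to the powers of A by A + D T: the summand D T gives the total
  for \<open>n - 1\<close>, and A gives the next difference.\<close>

lemma even_diff_rec:
  assumes "1 \<le> k" "Suc k < n"
  shows "even_diff n k = even_total (n - 1) k + even_diff n (Suc k)"
proof -
  obtain k' where k': "k = Suc k'" using assms by (cases k) auto
  define m where "m = n - k - 2"
  have m: "n - 1 - k = Suc m" "n - 1 - Suc k = m" "n - 1 - k - 1 = m" using assms by (auto simp: m_def)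
  define w where "w = (pair_high ^^ m) unit0"
  have "even_diff n k = (pair_low ^^ k') (plus_fun (pair_low w) (odd_step (shift w))) 0"
    using k' m by (simp add: even_diff_def w_def pair_high_eq)
  moreover have "k < n - 1" using assms by simp
  ultimately show ?thesis
    using k' m assms
    by (simp add: even_diff_def even_total_def funpow_pair_low_plus plus_fun_def w_def funpow_swap1)
qed

text \<open>The recurrence is summed downwards from \<open>k = n - 1\<close>, where no factor B is
  left and both sides are the same power of A on \<open>unit0\<close>.\<close>

lemma even_diff_eq_sum:
  assumes "1 \<le> k" "k \<le> n - 1"
  shows "even_diff n k = (\<Sum>i = k..n - 1. even_total (n - 1) i)"
  using assms(2,1)
proof (induction rule: inc_induct)
  case base
  then show ?case by (auto simp: even_diff_def even_total_def)
next
  case (step k)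
  then show ?case using even_diff_rec[of k n] by (simp add: sum.atLeast_Suc_atMost)
qed

lemma even_total_rec:
  assumes "n \<ge> 2" "k < n"
  shows "even_total n (Suc k) = even_total n k + (\<Sum>i = k..n - 1. even_total (n - 1) i)"
proof (cases "k = 0")
  case True
  \<comment> \<open>Both \<open>even_total n 0\<close> and the term \<open>i = 0\<close> vanish, so
    only the sum from 1 has to be matched.\<close>
  then show ?thesis using assms even_total_1[of n] even_diff_eq_sum[of 1 n]
    by (simp add: sum.atLeast_Suc_atMost[of 0])
next
  case False
  then show ?thesis using assms even_total_Suc[of k n] even_diff_eq_sum[of k n] by simp
qed

section \<open>Translating the removal of letters into operators\<close>

lemma num_fillings_empty: "num_fillings j {} L = of_bool (L = {})"
proof (cases "L = {}")
  case True
  then have "fillings j {} L = {\<lambda>_. []}" by (auto simp: fillings_def fun_eq_iff)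
  then show ?thesis using True by (simp add: num_fillings_def)
next
  case False
  then have "fillings j {} L = {}" by (auto simp: fillings_def)
  then show ?thesis using False by (simp add: num_fillings_def)
qed

lemma num_fillings_start_not_in:
  assumes "0 \<in> L" "j \<notin> X"
  shows "num_fillings j X L = 0"
proof -
  have False if "f \<in> fillings j X L" for f
  proof -
    have "f 0 \<noteq> []" "hd (f 0) = j" using that assms by (auto simp: fillings_def)
    then have "j \<in> set (f 0)" using hd_in_set by blast
    then show False using that assms(2) by (auto simp: fillings_def)
  qed
  then show ?thesis unfolding num_fillings_def by (metis card.empty equals0I)
qed

text \<open>The flag \<open>i\<close> tells whether the initial block 0 is present; it is not counted in \<open>card L\<close>.\<close>
definition counted_by :: "nat \<Rightarrow> nat \<Rightarrow> nat \<Rightarrow> (nat \<Rightarrow> nat) \<Rightarrow> bool \<Rightarrow> bool" where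
  "counted_by n j x q i \<longleftrightarrow> (\<forall>L \<subseteq> {1..<x}.
     num_fillings j {x..2 * n} (if i then insert 0 L else L) = q (card L))"

lemma interval_insert: "1 \<le> x \<Longrightarrow> x \<le> N \<Longrightarrow> {x..N} = insert x {Suc x..(N::nat)}"
  by auto

lemma counted_by_odd_without:
  assumes q: "counted_by n j (Suc x) q False" and x: "odd x" "x \<le> 2 * n"
  shows "counted_by n j x (\<lambda>b. b * (q b + q (Suc b))) False"
  unfolding counted_by_def
proof safe
  fix L assume L: "L \<subseteq> {1..<x}"
  then have fin: "finite L" "x \<notin> L" by (auto intro: finite_subset)
  have "x \<noteq> 0" using x by (cases x) auto
  have q': "num_fillings j {Suc x..2 * n} M = q (card M)" if "M \<subseteq> {1..<Suc x}" for M
    using q that by (simp add: counted_by_def)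
  have "L \<subseteq> {1..<Suc x}" "insert x L \<subseteq> {1..<Suc x}" using L x by (auto intro: Suc_leI odd_pos)
  note q'[OF this(1)] q'[OF this(2)]
  then show "num_fillings j {x..2 * n} (if False then insert 0 L else L) = card L * (q (card L) + q (Suc (card L)))"
    using fin x \<open>x \<noteq> 0\<close> by (simp add: interval_insert num_fillings_insert)
qed

text \<open>The initial block is one more place for \<open>x\<close>, so the factor is b + 1 instead
  of b, which gives D.\<close>

lemma counted_by_odd_with:
  assumes q: "counted_by n j (Suc x) q True" and x: "odd x" "x \<le> 2 * n"
  shows "counted_by n j x (odd_step q) True"
  unfolding counted_by_def
proof safe
  fix L assume L: "L \<subseteq> {1..<x}"
  then have fin: "finite L" "x \<notin> L" "0 \<notin> L" by (auto intro: finite_subset)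
  have "x \<noteq> 0" using x by (cases x) auto
  have q': "num_fillings j {Suc x..2 * n} (insert 0 M) = q (card M)" if "M \<subseteq> {1..<Suc x}" for M
    using q that by (simp add: counted_by_def)
  have "L \<subseteq> {1..<Suc x}" "insert x L \<subseteq> {1..<Suc x}" using L x by (auto intro: Suc_leI odd_pos)
  note q'[OF this(1)] q'[OF this(2)]
  then show "num_fillings j {x..2 * n} (if True then insert 0 L else L) = odd_step q (card L)"
    using fin x \<open>x \<noteq> 0\<close> by (simp add: interval_insert num_fillings_insert odd_step_def insert_commute[of x 0])
qed

lemma counted_by_even_without:
  assumes q: "counted_by n j (Suc x) q False" and x: "even x" "1 \<le> x" "x \<le> 2 * n"
  shows "counted_by n j x (\<lambda>b. b * (q b + shift q b)) False"
  unfolding counted_by_def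
proof safe
  fix L assume L: "L \<subseteq> {1..<x}"
  then have fin: "finite L" "x \<notin> L" "0 \<notin> L" by (auto intro: finite_subset)
  have q': "num_fillings j {Suc x..2 * n} M = q (card M)" if "M \<subseteq> {1..<Suc x}" for M
    using q that by (simp add: counted_by_def)
  have qL: "num_fillings j {Suc x..2 * n} L = q (card L)" using L by (intro q') auto
  have ql: "num_fillings j {Suc x..2 * n} (L - {l}) = shift q (card L)" if "l \<in> L" for l
  proof -
    have "card L = Suc (card (L - {l}))" using fin(1) that by (rule card.remove)
    moreover have "L - {l} \<subseteq> {1..<Suc x}" using L by auto
    ultimately show ?thesis using q' by (simp add: shift_def)
  qed
  have "num_fillings j {x..2 * n} L = (\<Sum>l\<in>L. q (card L) +
    (if l = 0 \<and> x \<noteq> j then 0 else num_fillings j {Suc x..2 * n} (L - {l})))"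
    using fin x by (simp only: interval_insert, subst num_fillings_insert) (auto simp: qL)
  also have "\<dots> = (\<Sum>l\<in>L. q (card L) + shift q (card L))"
  proof (rule sum.cong)
    fix l assume "l \<in> L"
    then show "q (card L) + (if l = 0 \<and> x \<noteq> j then 0 else num_fillings j {Suc x..2 * n} (L - {l}))
      = q (card L) + shift q (card L)"
      using ql fin(3) by (cases "l = 0") auto
  qed simp
  finally have "num_fillings j {x..2 * n} L = (\<Sum>l\<in>L. q (card L) + shift q (card L))" .
  then show "num_fillings j {x..2 * n} (if False then insert 0 L else L) = card L * (q (card L) + shift q (card L))"
    by simp
qed

text \<open>As \<open>x \<noteq> j\<close>, the initial block cannot consist of \<open>x\<close>
  alone and contributes \<open>q b\<close> only. The b others contribute
  \<open>q b + q (b - 1)\<close> each, and the total is T D q + q.\<close>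

lemma counted_by_even_with:
  assumes q: "counted_by n j (Suc x) q True" and x: "even x" "1 \<le> x" "x \<le> 2 * n" "x \<noteq> j"
  shows "counted_by n j x (plus_fun (shift (odd_step q)) q) True"
  unfolding counted_by_def
proof safe
  fix L assume L: "L \<subseteq> {1..<x}"
  then have fin: "finite L" "x \<notin> L" "0 \<notin> L" by (auto intro: finite_subset)
  have q': "num_fillings j {Suc x..2 * n} (insert 0 M) = q (card M)" if "M \<subseteq> {1..<Suc x}" for M
    using q that by (simp add: counted_by_def)
  have qL: "num_fillings j {Suc x..2 * n} (insert 0 L) = q (card L)" using L by (intro q') auto
  have ql: "num_fillings j {Suc x..2 * n} (insert 0 L - {l}) = shift q (card L)" if "l \<in> L" for l
  proof -
    have "card L = Suc (card (L - {l}))" using fin(1) that by (rule card.remove)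
    moreover have "L - {l} \<subseteq> {1..<Suc x}" using L by auto
    moreover have "insert 0 L - {l} = insert 0 (L - {l})" using that fin by auto
    ultimately show ?thesis using q' by (simp add: shift_def)
  qed
  have "num_fillings j {x..2 * n} (insert 0 L)
    = (\<Sum>l\<in>insert 0 L. q (card L) + (if l = 0 then 0 else shift q (card L)))"
    using fin x by (simp only: interval_insert, subst num_fillings_insert)
      (auto simp: qL intro!: sum.cong ql)
  also have "\<dots> = q (card L) + (\<Sum>l\<in>L. q (card L) + (if l = 0 then 0 else shift q (card L)))"
    using fin by simp
  also have "(\<Sum>l\<in>L. q (card L) + (if l = 0 then 0 else shift q (card L)))
    = (\<Sum>l\<in>L. q (card L) + shift q (card L))"
  proof (rule sum.cong)
    fix l assume "l \<in> L"
    then show "q (card L) + (if l = 0 then 0 else shift q (card L)) = q (card L) + shift q (card L)"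
      using fin(3) by (cases "l = 0") auto
  qed simp
  also have "q (card L) + (\<Sum>l\<in>L. q (card L) + shift q (card L))
    = q (card L) + card L * (q (card L) + shift q (card L))"
    by simp
  also have "\<dots> = plus_fun (shift (odd_step q)) q (card L)"
    by (cases "card L") (auto simp: plus_fun_def shift_def odd_step_def algebra_simps)
  finally show "num_fillings j {x..2 * n} (if True then insert 0 L else L) = plus_fun (shift (odd_step q)) q (card L)"
    by simp
qed

text \<open>The even letter \<open>j\<close> has to form the initial block alone, which then
  disappears. Any other place for \<open>j\<close> leaves an initial block that must start with
  \<open>j\<close>, a letter no longer available.\<close>

lemma counted_by_start:
  assumes q: "counted_by n j (Suc j) q False" and j: "even j" "1 \<le> j" "j \<le> 2 * n"
  shows "counted_by n j j q True"
  unfolding counted_by_def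
proof safe
  fix L assume L: "L \<subseteq> {1..<j}"
  then have fin: "finite L" "j \<notin> L" "0 \<notin> L" by (auto intro: finite_subset)
  have q': "num_fillings j {Suc j..2 * n} M = q (card M)" if "M \<subseteq> {1..<Suc j}" for M
    using q that by (simp add: counted_by_def)
  have qL: "num_fillings j {Suc j..2 * n} L = q (card L)" using L by (intro q') auto
  have ql: "num_fillings j {Suc j..2 * n} (insert 0 L - {l}) = 0" if "l \<in> L" for l
    using that fin by (intro num_fillings_start_not_in) (cases "l = 0"; simp)+
  have "num_fillings j {j..2 * n} (insert 0 L) = (\<Sum>l\<in>insert 0 L. if l = 0 then q (card L) else 0)"
    using fin j by (simp only: interval_insert, subst num_fillings_insert)
      (auto simp: qL ql num_fillings_start_not_in intro!: sum.cong)
  also have "\<dots> = q (card L)" using fin by simp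
  finally show "num_fillings j {j..2 * n} (if True then insert 0 L else L) = q (card L)" by simp
qed

lemma counted_by_top: "counted_by n j (Suc (2 * n)) unit0 False"
proof -
  have "L = {} \<longleftrightarrow> card L = 0" if "L \<subseteq> {1..<Suc (2 * n)}" for L
    using finite_subset[OF that] by auto
  then show ?thesis by (simp add: counted_by_def num_fillings_empty unit0_def)
qed

text \<open>Without an initial block, an even letter acts as T D and an odd one as an operator O
  with O T = T D. So a pair sends T w to T D D T w = T B w, which explains the outer
  \<open>shift\<close>.\<close>

lemma counted_by_pair_high:
  assumes "t < n"
  shows "counted_by n j (2 * t + 1) (shift ((pair_high ^^ (n - 1 - t)) unit0)) False"
proof -
  have le: "t \<le> n - 1" using assms by simp
  show ?thesis using le
  proof (induction rule: inc_induct)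
    case base
    have n: "2 * n = Suc (Suc (2 * (n - 1)))" using assms by simp
    define q where "q b = b * (unit0 b + shift unit0 b)" for b
    have "counted_by n j (2 * n) q False"
      unfolding q_def by (rule counted_by_even_without[OF counted_by_top]) (use assms in auto)
    then have "counted_by n j (2 * (n - 1) + 1) (\<lambda>b. b * (q b + q (Suc b))) False"
      by (intro counted_by_odd_without) (use n in auto)
    \<comment> \<open>The letters 2n - 1 and 2n fill exactly one block, in one way, because an odd
      letter cannot start a block.\<close>
    moreover have "(\<lambda>b. b * (q b + q (Suc b))) = shift unit0"
      by (auto simp: q_def shift_def unit0_def fun_eq_iff split: nat.split)
    ultimately show ?case by simp
  next
    case (step t)
    define w where "w = (pair_high ^^ (n - 1 - Suc t)) unit0"
    define q where "q b = b * (shift w b + shift (shift w) b)" for b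
    have "counted_by n j (2 * t + 2) q False"
      unfolding q_def by (rule counted_by_even_without) (use step w_def in auto)
    then have "counted_by n j (2 * t + 1) (\<lambda>b. b * (q b + q (Suc b))) False"
      by (intro counted_by_odd_without) (use step in auto)
    moreover have "(\<lambda>b. b * (q b + q (Suc b))) = shift (pair_high w)"
      by (auto simp: q_def shift_def pair_high_def odd_step_def fun_eq_iff algebra_simps split: nat.split)
    moreover have "n - 1 - t = Suc (n - 1 - Suc t)" using step by simp
    ultimately show ?case by (simp add: w_def)
  qed
qed

text \<open>The letters above 2k are handled without the initial block, 2k switches it on, and 2k -
  1 gives the innermost D. Each pair of letters below that gives a factor A. For
  \<open>k = n\<close> there is nothing above 2k, hence \<open>unit0\<close>.\<close>

lemma counted_by_pair_low:
  assumes "t < k" "k \<le> n"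
  shows "counted_by n (2 * k) (2 * t + 1) ((pair_low ^^ (k - 1 - t))
    (odd_step (if k < n then shift ((pair_high ^^ (n - 1 - k)) unit0) else unit0))) True"
proof -
  define q where "q = (if k < n then shift ((pair_high ^^ (n - 1 - k)) unit0) else unit0)"
  have le: "t \<le> k - 1" using assms by simp
  have "counted_by n (2 * k) (2 * t + 1) ((pair_low ^^ (k - 1 - t)) (odd_step q)) True"
    using le
  proof (induction rule: inc_induct)
    case base
    have "counted_by n (2 * k) (Suc (2 * k)) q False"
      using counted_by_pair_high[of k n "2 * k"] counted_by_top[of n "2 * n"] assms by (auto simp: q_def)
    then have "counted_by n (2 * k) (2 * k) q True"
      by (rule counted_by_start) (use assms in auto)
    moreover have "2 * k = Suc (2 * (k - 1) + 1)" using assms by simp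
    ultimately have "counted_by n (2 * k) (2 * (k - 1) + 1) (odd_step q) True"
      by (intro counted_by_odd_with) (use assms in auto)
    then show ?case by simp
  next
    case (step t)
    define w where "w = (pair_low ^^ (k - 1 - Suc t)) (odd_step q)"
    have "counted_by n (2 * k) (2 * t + 2) (plus_fun (shift (odd_step w)) w) True"
      by (rule counted_by_even_with) (use step assms w_def in auto)
    then have "counted_by n (2 * k) (2 * t + 1) (pair_low w) True"
      unfolding pair_low_def by (intro counted_by_odd_with) (use step assms in auto)
    moreover have "k - 1 - t = Suc (k - 1 - Suc t)" using step by simp
    ultimately show ?case by (simp add: w_def)
  qed
  then show ?thesis by (simp add: q_def)
qed

section \<open>From permutations to fillings\<close>

text \<open>A permutation is a filling of the single block 0. Requiring
  \<open>\<pi> \<noteq> []\<close> keeps out the empty permutation, whose head is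
  unspecified.\<close>

lemma card_perms_GI_hd:
  assumes "even j" "1 \<le> j"
  shows "card {\<pi> \<in> perms_GI n. hd \<pi> = j \<and> \<pi> \<noteq> []} = num_fillings j {1..2 * n} {0}"
proof -
  have GI: "\<pi> \<in> perms_GI n \<longleftrightarrow> distinct \<pi> \<and> set \<pi> = {1..2 * n} \<and> successively allowed \<pi>" for \<pi>
    by (auto simp: perms_GI_def permutations_of_set_def successively_conv_nth allowed_def)
  have "bij_betw (\<lambda>\<pi>. (\<lambda>_. [])(0 := \<pi>)) {\<pi> \<in> perms_GI n. hd \<pi> = j \<and> \<pi> \<noteq> []} (fillings j {1..2 * n} {0})"
  proof (rule bij_betw_byWitness[where f' = "\<lambda>f. f 0"])
    show "\<forall>f\<in>fillings j {1..2 * n} {0}. (\<lambda>_. [])(0 := f 0) = f"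
    proof (intro ballI ext)
      fix f l assume "f \<in> fillings j {1..2 * n} {0}"
      then have "f l = [] \<longleftrightarrow> l \<noteq> 0" using fillings_nonempty_iff[of f j _ "{0}" l] by auto
      then show "((\<lambda>_. [])(0 := f 0)) l = f l" by (cases "l = 0") auto
    qed
    show "(\<lambda>\<pi>. (\<lambda>_. [])(0 := \<pi>)) ` {\<pi> \<in> perms_GI n. hd \<pi> = j \<and> \<pi> \<noteq> []} \<subseteq> fillings j {1..2 * n} {0}"
    proof safe
      fix \<pi> assume \<pi>: "\<pi> \<in> perms_GI n" "\<pi> \<noteq> []" "j = hd \<pi>"
      define f :: "nat \<Rightarrow> nat list" where "f = (\<lambda>_. [])(0 := \<pi>)"
      have f: "f 0 = \<pi>" "f l = (if l = 0 then \<pi> else [])" for l by (auto simp: f_def)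
      have "\<exists>l. y \<in> set (f l)" if "y \<in> {1..2 * n}" for y
        using that \<pi>(1) by (intro exI[of _ 0]) (auto simp: f GI)
      moreover have "y \<in> {1..2 * n}" if "y \<in> set (f l)" for l y
        using that \<pi>(1) by (auto simp: f GI split: if_splits)
      moreover have "l = l'" if "y \<in> set (f l)" "y \<in> set (f l')" for l l' y
        using that by (auto simp: f split: if_splits)
      moreover have "distinct (f l) \<and> successively allowed (f l)" "f l \<noteq> [] \<longleftrightarrow> l \<in> {0}" for l
        using \<pi> by (auto simp: f GI)
      moreover have "\<forall>l\<in>{0}. even (hd (f l)) \<and> (l = 0 \<longrightarrow> hd (f l) = j)"
        using \<pi> assms by (simp add: f)
      ultimately have "f \<in> fillings j {1..2 * n} {0}"
        unfolding fillings_def by blast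
      then show "(\<lambda>_. [])(0 := \<pi>) \<in> fillings (hd \<pi>) {1..2 * n} {0}"
        unfolding f_def \<pi>(3) .
    qed
    show "(\<lambda>f. f 0) ` fillings j {1..2 * n} {0} \<subseteq> {\<pi> \<in> perms_GI n. hd \<pi> = j \<and> \<pi> \<noteq> []}"
    proof safe
      fix f assume f: "f \<in> fillings j {1..2 * n} {0}"
      have f0: "f l = []" if "l \<noteq> 0" for l
        using that fillings_nonempty_iff[OF f, of l] by auto
      have "set (f 0) = {1..2 * n}"
      proof
        show "set (f 0) \<subseteq> {1..2 * n}" using f unfolding fillings_def by blast
        show "{1..2 * n} \<subseteq> set (f 0)"
        proof
          fix y assume "y \<in> {1..2 * n}"
          then obtain l where "y \<in> set (f l)" using f unfolding fillings_def by blast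
          then show "y \<in> set (f 0)" using f0[of l] by (cases "l = 0") auto
        qed
      qed
      then show "f 0 \<in> perms_GI n" using f by (auto simp: GI fillings_def)
    qed (auto simp: fillings_def)
  qed auto
  then show ?thesis unfolding num_fillings_def by (rule bij_betw_same_card)
qed

lemma num_GI_even:
  assumes "k \<le> n"
  shows "num_GI n (2 * k) = even_total n k"
proof (cases "k = 0")
  case True
  then show ?thesis by (simp add: num_GI_def)
next
  case False
  have "num_GI n (2 * k) = card {\<pi> \<in> perms_GI n. hd \<pi> = 2 * k \<and> \<pi> \<noteq> []}"
    using assms False by (auto simp: num_GI_def perms_GI_def permutations_of_set_def intro!: arg_cong[where f = card])
  also have "\<dots> = num_fillings (2 * k) {1..2 * n} {0}"
    using False by (intro card_perms_GI_hd) auto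
  \<comment> \<open>Taking \<open>t = 0\<close> and \<open>L = {}\<close> leaves the initial block
    as the only one, hence the value at 0. For \<open>k = n\<close> the innermost D disappears
    because it fixes \<open>unit0\<close>.\<close>
  also have "\<dots> = even_total n k"
    using counted_by_pair_low[of 0 k n] False assms
    by (auto simp: counted_by_def even_total_def odd_step_unit0)
  finally show ?thesis .
qed

theorem theorem1p6:
  fixes n k :: nat
  assumes "n \<ge> 2" and "k < n"
  shows "num_GI n (2 * k + 2) = num_GI n (2 * k) + (\<Sum>i = k..n - 1. num_GI (n - 1) (2 * i))"
proof -
  have "num_GI n (2 * k + 2) = even_total n (Suc k)"
    using num_GI_even[of "Suc k" n] assms by simp
  then show ?thesis
    using even_total_rec[OF assms] num_GI_even[of k n] num_GI_even[of _ "n - 1"] assms by simp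
qed

end
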